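(* Let $n\ge 3$ and let $T\subset\mathbb{R}^n$ be a compact set with $N(T,\delta)\le C\delta^{-(n-1)}$ for all $\delta\in(0,1/2)$. For $\delta\in(0,1/2)$ define \[ N^\delta_{S,T} f(x)=\sup_{u\in T}\sup_{1\le t\le 2}\frac{1}{|S^\delta(0)|}\Big|\int_{S^\delta(0)}f(x+t(u+y))\,dy\Big|. \] Then there is a constant $C'$ independent of $\delta$ and $f$ such that $\|N^\delta_{S,T}f\|_{L^2(\mathbb{R}^n)}\le C'(\log\delta^{-1})^{1/2}\|f\|_{L^2(\mathbb{R}^n)}$ for all $\delta\in(0,1/2)$.
   Context: $N(T,\delta)$ is the minimal number of balls of radius $\delta$ covering $T$. $S^\delta(0)$ is the $\delta$-neighborhood of the unit sphere $\mathbb{S}^{n-1}$ and $|\cdot|$ is Lebesgue measure. *)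

theory Defs
  imports "HOL-Analysis.Analysis"
begin

definition covering_number :: "'a::metric_space set \<Rightarrow> real \<Rightarrow> nat" where
  "covering_number T \<delta> =
     Inf {card F | F. finite F \<and> T \<subseteq> (\<Union>c\<in>F. ball c \<delta>)}"

definition sphere_nbhd :: "real \<Rightarrow> 'a::euclidean_space set" where
  "sphere_nbhd \<delta> = {y. infdist y (sphere 0 1) < \<delta>}"

definition max_op :: "real \<Rightarrow> 'a::euclidean_space set \<Rightarrow> ('a \<Rightarrow> real) \<Rightarrow> 'a \<Rightarrow> ennreal" where
  "max_op \<delta> T f x =
     (SUP u\<in>T. SUP t\<in>{1..2}.
        ennreal (\<bar>set_lebesgue_integral lebesgue (sphere_nbhd \<delta>) (\<lambda>y. f (x + t *\<^sub>R (u + y)))\<bar>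
                 / measure lebesgue (sphere_nbhd \<delta> :: 'a set)))"

end

theory Submission
  imports Defs
begin

text \<open>This is a \<open>TT\<^sup>*\<close> argument in the style of Cordoba. After discretizing and linearizing the supremum, the kernel of
  \<open>TT\<^sup>*\<close> is the volume of the intersection of two annuli of thickness about \<open>\<delta>\<close>. In dimension at least three
  it is at most a multiple of \<open>\<delta>\<^sup>2 / (d + \<delta>)\<close>, with \<open>d\<close> the distance of the centers, tangent spheres included:
  subtracting the two quadratic conditions leaves a slab of width \<open>\<delta> / d\<close>, and two free directions orthogonal to
  it remain for the shell condition. The annuli are disjoint unless their radii differ by \<open>O(d + \<delta>)\<close>; then the
  base point lies in an \<open>O(\<rho>)\<close>-neighbourhood of a dilate of \<open>-T\<close> when \<open>d \<le> \<rho>\<close>, a set of measure \<open>O(\<rho>)\<close> by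
  the covering hypothesis. Summing over dyadic \<open>\<rho>\<close> between \<open>\<delta>\<close> and \<open>1\<close> costs the logarithm.\<close>

section \<open>Volumes of annuli and of their pairwise intersections\<close>

lemma nn_integral_lborel_translate:
  fixes g :: "'a::euclidean_space \<Rightarrow> ennreal"
  assumes [measurable]: "g \<in> borel_measurable borel"
  shows "(\<integral>\<^sup>+ z. g (z + a) \<partial>lborel) = (\<integral>\<^sup>+ z. g z \<partial>lborel)"
proof -
  have "(\<integral>\<^sup>+ z. g z \<partial>lborel) = (\<integral>\<^sup>+ z. g z \<partial>(distr lborel borel ((+) a)))"
    by (simp add: lborel_distr_plus)
  also have "\<dots> = (\<integral>\<^sup>+ z. g (a + z) \<partial>lborel)"
    by (rule nn_integral_distr) auto
  finally show ?thesis by (simp add: add.commute)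
qed

text \<open>The area of a disc is linear in its squared radius, so the bound does not depend on
  \<alpha>. This uniformity is what covers tangent spheres: with one free variable instead of two,
  the case \<alpha> = 0 would already give a length of order \<open>sqrt L\<close>.\<close>

lemma emeasure_planar_shell_le:
  assumes "L \<ge> 0"
  shows "emeasure lborel {y :: real \<times> real. \<alpha> \<le> (norm y)\<^sup>2 \<and> (norm y)\<^sup>2 \<le> \<alpha> + L} \<le> ennreal (pi * L)"
    (is "emeasure lborel ?S \<le> _")
proof (cases "\<alpha> + L < 0")
  case True
  then have "?S = {}"
    using zero_le_power2 by (auto simp: not_le) (meson less_le_trans not_less zero_le_power2)
  then show ?thesis by (simp only: emeasure_empty zero_le)
next
  case False
  define r where "r = sqrt (max \<alpha> 0)"
  define s where "s = sqrt (\<alpha> + L)"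
  have rs: "0 \<le> r" "r \<le> s" "0 \<le> s"
    using False assms by (auto simp: r_def s_def)
  have "?S \<subseteq> cball 0 s - ball 0 r"
  proof
    fix y :: "real \<times> real" assume "y \<in> ?S"
    then have *: "max \<alpha> 0 \<le> (norm y)\<^sup>2" "(norm y)\<^sup>2 \<le> \<alpha> + L" by auto
    have "norm y \<le> s" unfolding s_def using *(2) by (rule real_le_rsqrt)
    moreover have "r \<le> norm y" unfolding r_def using *(1) by (rule real_le_lsqrt[rotated]) auto
    ultimately show "y \<in> cball 0 s - ball 0 r" by simp
  qed
  then have "emeasure lborel ?S \<le> emeasure lborel (cball (0 :: real \<times> real) s - ball 0 r)"
    by (intro emeasure_mono) auto
  also have "\<dots> = emeasure lborel (cball (0 :: real \<times> real) s) - emeasure lborel (ball (0 :: real \<times> real) r)"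
    using rs by (intro emeasure_Diff) (auto simp: emeasure_ball)
  also have "\<dots> = ennreal (pi * s\<^sup>2 - pi * r\<^sup>2)"
    using rs by (simp add: emeasure_cball emeasure_ball unit_ball_vol_2 ennreal_minus power2_eq_square)
  also have "\<dots> \<le> ennreal (pi * L)"
    using False assms by (intro ennreal_leI) (auto simp: r_def s_def max_def algebra_simps mult_nonneg_nonpos)
  finally show ?thesis .
qed

text \<open>This is where the dimension enters: besides the direction \<open>e\<close> of the slab
  there must be room for the two directions in which the planar estimate is applied.\<close>

lemma exists_orthonormal_complement_pair:
  fixes e :: "'a::euclidean_space"
  assumes "DIM('a) \<ge> 3"
  obtains a b :: 'a where "norm a = 1" "norm b = 1" "a \<bullet> b = 0" "e \<bullet> a = 0" "e \<bullet> b = 0"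
proof -
  have unit: "\<exists>c. norm c = 1 \<and> (\<forall>x\<in>S. x \<bullet> c = 0)" if "finite S" "card S < DIM('a)" for S :: "'a set"
  proof -
    have "dim S < DIM('a)" using dim_le_card'[OF that(1)] that(2) by linarith
    then obtain c :: 'a where c: "c \<noteq> 0" "\<And>y. y \<in> span S \<Longrightarrow> orthogonal c y"
      using orthogonal_to_subspace_exists by metis
    have "norm (c /\<^sub>R norm c) = 1" using c(1) by simp
    moreover have "x \<bullet> (c /\<^sub>R norm c) = 0" if "x \<in> S" for x
      using c(2)[OF span_base[OF that]] by (simp add: orthogonal_def inner_commute)
    ultimately show ?thesis by blast
  qed
  obtain a where a: "norm a = 1" "e \<bullet> a = 0" using unit[of "{e}"] assms by auto
  have "card {e, a} < DIM('a)" using card_insert_le_m1[of 2 "{a}" e] assms by (simp add: card_insert_if)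
  then obtain b where "norm b = 1" "e \<bullet> b = 0" "a \<bullet> b = 0" using unit[of "{e, a}"] by auto
  with a that show thesis by blast
qed

text \<open>Averaging over the translations by \<open>s e + p a + q b\<close> with \<open>(s, p, q)\<close> in the unit cube replaces
  slicing: it needs no decomposition of the Lebesgue measure along the frame \<open>e, a, b\<close>.\<close>

lemma emeasure_slab_shell_le:
  fixes e :: "'a::euclidean_space"
  assumes dim: "DIM('a) \<ge> 3" and e: "norm e = 1" and "w \<ge> 0" "L \<ge> 0" "R \<ge> 0"
  shows "emeasure lborel {z. norm z \<le> R \<and> z \<bullet> e \<in> {\<beta>..\<beta> + w} \<and> (norm z)\<^sup>2 \<in> {\<alpha>..\<alpha> + L}}
    \<le> ennreal (pi * measure lborel (cball (0::'a) (R + 3)) * (w * L))"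
    (is "emeasure lborel ?E \<le> _")
proof -
  obtain a b :: 'a where ab: "norm a = 1" "norm b = 1" "a \<bullet> b = 0" "e \<bullet> a = 0" "e \<bullet> b = 0"
    using exists_orthonormal_complement_pair[OF dim] by blast
  define \<tau> where "\<tau> = (\<lambda>s (y :: real \<times> real). s *\<^sub>R e + fst y *\<^sub>R a + snd y *\<^sub>R b)"
  have \<tau>_pair: "(\<lambda>p. \<tau> (fst p) (snd p)) \<in> borel_measurable (borel \<Otimes>\<^sub>M borel)"
    unfolding \<tau>_def borel_prod by (intro borel_measurable_continuous_onI continuous_intros)
  have [measurable]: "(\<lambda>x. \<tau> (f x) (g x)) \<in> borel_measurable M"
    if "f \<in> borel_measurable M" "g \<in> borel_measurable M" for f g and M :: "'c measure"
    using measurable_compose[OF measurable_Pair[OF that] \<tau>_pair] by simp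
  have [measurable]: "?E \<in> sets borel" 
    by measurable
  let ?I = "{0..1::real}" let ?Q = "{0..1::real} \<times> {0..1::real}"
  have [measurable]: "?Q \<in> sets borel" by (intro borel_closed closed_Times) auto
  have Qarea: "emeasure lborel ?Q = 1"
    by (simp add: lborel_prod[symmetric] lborel.emeasure_pair_measure_Times)
  have cball_sets: "cball (0 :: 'a) (R + 3) \<in> sets lborel" by simp
  have translated: "(\<integral>\<^sup>+ z. indicator ?E (z + c) \<partial>lborel) = emeasure lborel ?E" for c
    by (subst nn_integral_lborel_translate) auto
  have inner: "(\<integral>\<^sup>+ s. \<integral>\<^sup>+ y. indicator ?I s * indicator ?Q y * indicator ?E (z + \<tau> s y) \<partial>lborel \<partial>lborel)
      \<le> ennreal (pi * L) * (ennreal w * indicator (cball 0 (R + 3)) z)" for z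
  proof -
    have bound: "(\<integral>\<^sup>+ y. indicator ?I s * indicator ?Q y * indicator ?E (z + \<tau> s y) \<partial>lborel)
      \<le> ennreal (pi * L) * (indicator {\<beta> - z \<bullet> e..\<beta> - z \<bullet> e + w} s * indicator (cball 0 (R + 3)) z)" for s
    proof -
      \<comment> \<open>Completing the square in \<open>y\<close> leaves \<gamma> as the part of the
        squared norm that does not depend on \<open>y\<close>. For fixed \<open>z\<close> and
        \<open>s\<close> the shell condition thus becomes a planar shell condition on a translate of
        \<open>y\<close>.\<close>
      define \<gamma> where "\<gamma> = (norm (z + s *\<^sub>R e))\<^sup>2 - (z \<bullet> a)\<^sup>2 - (z \<bullet> b)\<^sup>2"
      let ?S = "{y :: real \<times> real. \<alpha> - \<gamma> \<le> (norm y)\<^sup>2 \<and> (norm y)\<^sup>2 \<le> \<alpha> - \<gamma> + L}"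
      have "?S \<in> sets borel" by measurable
      have ip: "a \<bullet> a = 1" "b \<bullet> b = 1" "e \<bullet> e = 1" "b \<bullet> a = 0" "a \<bullet> e = 0" "b \<bullet> e = 0"
        using ab e by (simp_all add: norm_eq_1 inner_commute)
      have sq: "(norm (z + \<tau> s y))\<^sup>2 = \<gamma> + (norm (y + (z \<bullet> a, z \<bullet> b)))\<^sup>2" for y
        unfolding \<gamma>_def \<tau>_def power2_norm_eq_inner inner_prod_def
        using ab ip by (simp add: inner_simps inner_commute algebra_simps power2_eq_square)
      have slab: "(z + \<tau> s y) \<bullet> e = z \<bullet> e + s" for y
        unfolding \<tau>_def using ab ip by (simp add: inner_simps)
      have "indicator ?I s * indicator ?Q y * indicator ?E (z + \<tau> s y)
        \<le> (indicator ?S (y + (z \<bullet> a, z \<bullet> b)) :: ennreal) * 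
          (indicator {\<beta> - z \<bullet> e..\<beta> - z \<bullet> e + w} s * indicator (cball 0 (R + 3)) z)" for y
      proof (cases "s \<in> ?I \<and> y \<in> ?Q \<and> z + \<tau> s y \<in> ?E")
        case True
        \<comment> \<open>Shifts by points of the unit cube have norm at most 3, so only
          \<open>z\<close> in the ball of radius \<open>R + 3\<close> contributes.\<close>
        have "norm (\<tau> s y) \<le> norm (s *\<^sub>R e) + norm (fst y *\<^sub>R a) + norm (snd y *\<^sub>R b)"
          unfolding \<tau>_def
          using norm_triangle_ineq[of "s *\<^sub>R e + fst y *\<^sub>R a" "snd y *\<^sub>R b"]
            norm_triangle_ineq[of "s *\<^sub>R e" "fst y *\<^sub>R a"] by linarith
        also have "\<dots> \<le> 3" using True e ab by auto
        finally have "norm z \<le> R + 3" using True norm_triangle_ineq4[of "z + \<tau> s y" "\<tau> s y"] by simp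
        then show ?thesis using True by (simp add: sq slab)
      qed (auto simp: indicator_def)
      then have "(\<integral>\<^sup>+ y. indicator ?I s * indicator ?Q y * indicator ?E (z + \<tau> s y) \<partial>lborel)
        \<le> (\<integral>\<^sup>+ y. indicator ?S (y + (z \<bullet> a, z \<bullet> b)) * 
          (indicator {\<beta> - z \<bullet> e..\<beta> - z \<bullet> e + w} s * indicator (cball 0 (R + 3)) z) \<partial>lborel)"
        by (rule nn_integral_mono)
      also have "\<dots> = (\<integral>\<^sup>+ y. indicator ?S (y + (z \<bullet> a, z \<bullet> b)) \<partial>lborel) *
          (indicator {\<beta> - z \<bullet> e..\<beta> - z \<bullet> e + w} s * indicator (cball 0 (R + 3)) z)"
        by (rule nn_integral_multc) (use \<open>?S \<in> sets borel\<close> in measurable)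
      also have "(\<integral>\<^sup>+ y. indicator ?S (y + (z \<bullet> a, z \<bullet> b)) \<partial>lborel) = emeasure lborel ?S"
        using \<open>?S \<in> sets borel\<close> by (subst nn_integral_lborel_translate) auto
      also have "emeasure lborel ?S \<le> ennreal (pi * L)"
        by (rule emeasure_planar_shell_le) fact
      finally show ?thesis by (simp add: mult_right_mono)
    qed
    have "(\<integral>\<^sup>+ s. \<integral>\<^sup>+ y. indicator ?I s * indicator ?Q y * indicator ?E (z + \<tau> s y) \<partial>lborel \<partial>lborel)
      \<le> (\<integral>\<^sup>+ s. ennreal (pi * L) * (indicator {\<beta> - z \<bullet> e..\<beta> - z \<bullet> e + w} s * indicator (cball 0 (R + 3)) z) \<partial>lborel)"
      by (intro nn_integral_mono bound)
    also have "\<dots> = ennreal (pi * L) * (ennreal w * indicator (cball 0 (R + 3)) z)"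
      using \<open>w \<ge> 0\<close> by (simp add: nn_integral_cmult nn_integral_multc)
    finally show ?thesis .
  qed
  \<comment> \<open>The cube has volume one and every translate of the set has the same measure, so
    the average over the cube is the measure itself. Two exchanges of integrals then move
    \<open>z\<close> outermost, where \<open>inner\<close> applies.\<close>
  have "emeasure lborel ?E = (\<integral>\<^sup>+ s. \<integral>\<^sup>+ y. indicator ?I s * indicator ?Q y * emeasure lborel ?E \<partial>lborel \<partial>lborel)"
    by (simp add: nn_integral_multc nn_integral_cmult Qarea)
  also have "\<dots> = (\<integral>\<^sup>+ s. \<integral>\<^sup>+ y. \<integral>\<^sup>+ z. indicator ?I s * indicator ?Q y * indicator ?E (z + \<tau> s y) \<partial>lborel \<partial>lborel \<partial>lborel)"
    by (intro nn_integral_cong, subst nn_integral_cmult) (measurable, simp only: translated)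
  also have "\<dots> = (\<integral>\<^sup>+ s. \<integral>\<^sup>+ z. \<integral>\<^sup>+ y. indicator ?I s * indicator ?Q y * indicator ?E (z + \<tau> s y) \<partial>lborel \<partial>lborel \<partial>lborel)"
    by (intro nn_integral_cong lborel_pair.Fubini') measurable
  also have "\<dots> = (\<integral>\<^sup>+ z. \<integral>\<^sup>+ s. \<integral>\<^sup>+ y. indicator ?I s * indicator ?Q y * indicator ?E (z + \<tau> s y) \<partial>lborel \<partial>lborel \<partial>lborel)"
    by (rule lborel_pair.Fubini') measurable
  also have "\<dots> \<le> (\<integral>\<^sup>+ z. ennreal (pi * L) * (ennreal w * indicator (cball 0 (R + 3)) (z :: 'a)) \<partial>lborel)"
    by (intro nn_integral_mono inner)
  also have "\<dots> = ennreal (pi * L) * (ennreal w * emeasure lborel (cball (0::'a) (R + 3)))"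
    using nn_integral_cmult_indicator[OF cball_sets, of "ennreal (pi * L) * ennreal w"] by (simp only: mult.assoc)
  also have "emeasure lborel (cball (0::'a) (R + 3)) = ennreal (measure lborel (cball (0::'a) (R + 3)))"
    using emeasure_lborel_cball_finite[of "0::'a" "R + 3"] by (simp add: emeasure_eq_ennreal_measure)
  finally show ?thesis
    using assms by (simp add: ennreal_mult[symmetric] algebra_simps)
qed

definition annulus :: "'a::metric_space \<Rightarrow> real \<Rightarrow> real \<Rightarrow> 'a set" where
  "annulus c t \<eta> = {z. \<bar>dist z c - t\<bar> < \<eta>}"

lemma annulus_borel [measurable]:
  fixes c :: "'a::euclidean_space"
  shows "annulus c t \<eta> \<in> sets borel"
  unfolding annulus_def by measurable

lemma emeasure_lborel_translate:
  fixes c :: "'a::euclidean_space"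
  assumes [measurable]: "E \<in> sets borel"
  shows "emeasure lborel {z. z - c \<in> E} = emeasure lborel E"
proof -
  have "{z. z - c \<in> E} \<in> sets borel" by measurable
  then have "emeasure lborel {z. z - c \<in> E} = (\<integral>\<^sup>+ z. indicator {z. z - c \<in> E} z \<partial>lborel)"
    by simp
  also have "\<dots> = (\<integral>\<^sup>+ z. indicator E (z + - c) \<partial>lborel)"
    by (intro nn_integral_cong) (simp add: indicator_def)
  also have "\<dots> = emeasure lborel E"
    by (subst nn_integral_lborel_translate) auto
  finally show ?thesis .
qed

text \<open>Factor the difference of squares and use \<open>r + t \<le> 2 + 2 + 2\<close>. This
  turns the radial condition of an annulus into a shell condition on the squared distance.\<close>

lemma abs_square_diff_le:
  fixes r t \<eta> :: real
  assumes "\<bar>r - t\<bar> < \<eta>" "0 \<le> r" "t \<in> {1..2}" "\<eta> \<le> 2"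
  shows "\<bar>r\<^sup>2 - t\<^sup>2\<bar> \<le> 6 * \<eta>"
proof -
  have "\<bar>r\<^sup>2 - t\<^sup>2\<bar> = \<bar>r - t\<bar> * \<bar>r + t\<bar>"
    by (simp add: power2_eq_square abs_mult[symmetric] algebra_simps)
  also have "\<dots> \<le> \<eta> * 6"
    using assms by (intro mult_mono) auto
  finally show ?thesis by simp
qed

text \<open>Both bounds come from the slab-shell estimate with \<open>R = 4\<close>, as points of an
  annulus have distance less than 2 + 2 from its center. A single annulus lies in a slab of width 8
  in any direction, giving \<open>8 * 12 * \<eta>\<close>; two annuli confine the point to a slab of
  width \<open>12 * \<eta> / d\<close> orthogonal to the line of centers, giving
  \<open>144 * \<eta>\<^sup>2 / d\<close>. The factor 144 serves for both.\<close>

lemma emeasure_annulus_bounds: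
  assumes dim: "DIM('a::euclidean_space) \<ge> 3"
  obtains A :: real where "A > 0"
    "\<And>(c :: 'a) t \<eta>. t \<in> {1..2} \<Longrightarrow> 0 < \<eta> \<Longrightarrow> \<eta> \<le> 2 \<Longrightarrow> emeasure lborel (annulus c t \<eta>) \<le> ennreal (A * \<eta>)"
    "\<And>(c :: 'a) c' t t' \<eta>. c \<noteq> c' \<Longrightarrow> t \<in> {1..2} \<Longrightarrow> t' \<in> {1..2} \<Longrightarrow> 0 < \<eta> \<Longrightarrow> \<eta> \<le> 2 \<Longrightarrow>
       emeasure lborel (annulus c t \<eta> \<inter> annulus c' t' \<eta>) \<le> ennreal (A * \<eta>\<^sup>2 / dist c c')"
proof
  define \<kappa> where "\<kappa> = pi * measure lborel (cball (0::'a) (4 + 3))"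
  have \<kappa>: "\<kappa> > 0" unfolding \<kappa>_def by (simp add: content_cball_pos)
  then show "\<kappa> * 144 > 0" by simp
  have slab: "emeasure lborel {z. norm (z - c) \<le> 4 \<and> (z - c) \<bullet> e \<in> {\<beta>..\<beta> + w} \<and> (norm (z - c))\<^sup>2 \<in> {\<alpha>..\<alpha> + L}}
      \<le> ennreal (\<kappa> * (w * L))" if "norm e = 1" "w \<ge> 0" "L \<ge> 0" for c e :: 'a and w L \<alpha> \<beta>
  proof -
    let ?E = "{z. norm z \<le> 4 \<and> z \<bullet> e \<in> {\<beta>..\<beta> + w} \<and> (norm z)\<^sup>2 \<in> {\<alpha>..\<alpha> + L}}"
    have "?E \<in> sets borel" by measurable
    from emeasure_lborel_translate[OF this, of c] show ?thesis
      using emeasure_slab_shell_le[OF dim that(1), of w L 4 \<beta> \<alpha>] that unfolding \<kappa>_def by simp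
  qed
  fix c :: 'a and t \<eta> :: real
  assume t: "t \<in> {1..2}" and \<eta>: "0 < \<eta>" "\<eta> \<le> 2"
  have shell: "norm (z - c) \<le> 4 \<and> (norm (z - c))\<^sup>2 \<in> {t\<^sup>2 - 6 * \<eta>..t\<^sup>2 - 6 * \<eta> + 12 * \<eta>}"
    if "z \<in> annulus c t \<eta>" for z
    using that t \<eta> abs_square_diff_le[of "norm (z - c)" t \<eta>]
    unfolding annulus_def dist_norm abs_le_iff by auto
  {
    obtain e :: 'a where e: "norm e = 1" using vector_choose_size[of 1] by auto
    have "(z - c) \<bullet> e \<in> {-4..-4 + 8}" if "z \<in> annulus c t \<eta>" for z
      using Cauchy_Schwarz_ineq2[of "z - c" e] shell[OF that] e by auto
    with shell have "emeasure lborel (annulus c t \<eta>) \<le> emeasure lborel {z. norm (z - c) \<le> 4 \<and>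
        (z - c) \<bullet> e \<in> {-4..-4 + 8} \<and> (norm (z - c))\<^sup>2 \<in> {t\<^sup>2 - 6 * \<eta>..t\<^sup>2 - 6 * \<eta> + 12 * \<eta>}}"
      by (intro emeasure_mono) (auto, measurable)
    also have "\<dots> \<le> ennreal (\<kappa> * (8 * (12 * \<eta>)))"
      using e \<eta> by (intro slab) auto
    also have "\<dots> \<le> ennreal (\<kappa> * 144 * \<eta>)"
      using \<eta> \<kappa> by (intro ennreal_leI) simp
    finally show "emeasure lborel (annulus c t \<eta>) \<le> ennreal (\<kappa> * 144 * \<eta>)" .
  }
  fix c' :: 'a and t' :: real
  assume cc: "c \<noteq> c'" and t': "t' \<in> {1..2}"
  define d where "d = dist c c'"
  have d: "d > 0" using cc by (simp add: d_def)
  define e where "e = (c' - c) /\<^sub>R d"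
  have e: "norm e = 1" using d by (simp add: e_def d_def dist_norm norm_minus_commute)
  \<comment> \<open>By the law of cosines, \<open>2 * d\<close> times the coordinate of
    \<open>z - c\<close> along \<open>e\<close> is the squared distance to \<open>c\<close> minus
    that to \<open>c'\<close> plus \<open>d\<^sup>2\<close>. Each squared distance is within
    \<open>6 * \<eta>\<close> of the squared radius, and \<beta> is the resulting lower end.\<close>
  define \<beta> where "\<beta> = (t\<^sup>2 - t'\<^sup>2 + d\<^sup>2 - 12 * \<eta>) / (2 * d)"
  have "(z - c) \<bullet> e \<in> {\<beta>..\<beta> + 12 * \<eta> / d}" if z: "z \<in> annulus c t \<eta> \<inter> annulus c' t' \<eta>" for z
  proof -
    have 1: "\<bar>(norm (z - c))\<^sup>2 - t\<^sup>2\<bar> \<le> 6 * \<eta>" "\<bar>(norm (z - c'))\<^sup>2 - t'\<^sup>2\<bar> \<le> 6 * \<eta>"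
      using z t t' \<eta> by (auto intro!: abs_square_diff_le simp: annulus_def dist_norm)
    have "z - c' = (z - c) - (c' - c)" by simp
    then have "(norm (z - c'))\<^sup>2 = (norm (z - c))\<^sup>2 + d\<^sup>2 - 2 * ((z - c) \<bullet> (c' - c))"
      unfolding d_def dist_norm norm_minus_commute[of c c'] power2_norm_eq_inner
      by (simp only: inner_diff_left inner_diff_right inner_commute) simp
    moreover have "(z - c) \<bullet> e = ((z - c) \<bullet> (c' - c)) / d"
      by (simp only: e_def inner_scaleR_right divide_inverse_commute)
    ultimately have 2: "(z - c) \<bullet> e = ((norm (z - c))\<^sup>2 - (norm (z - c'))\<^sup>2 + d\<^sup>2) / (2 * d)"
      using d by (simp add: field_simps)
    have 3: "{\<beta>..\<beta> + 12 * \<eta> / d} = {\<beta>.. (t\<^sup>2 - t'\<^sup>2 + d\<^sup>2 + 12 * \<eta>) / (2 * d)}"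
      using d by (simp add: \<beta>_def field_simps)
    show ?thesis
      unfolding 3 2 using 1 d by (auto intro!: divide_right_mono simp: \<beta>_def abs_le_iff)
  qed
  with shell have "emeasure lborel (annulus c t \<eta> \<inter> annulus c' t' \<eta>) \<le> emeasure lborel {z. norm (z - c) \<le> 4 \<and>
      (z - c) \<bullet> e \<in> {\<beta>..\<beta> + 12 * \<eta> / d} \<and> (norm (z - c))\<^sup>2 \<in> {t\<^sup>2 - 6 * \<eta>..t\<^sup>2 - 6 * \<eta> + 12 * \<eta>}}"
    by (intro emeasure_mono) (auto, measurable)
  also have "\<dots> \<le> ennreal (\<kappa> * (12 * \<eta> / d * (12 * \<eta>)))"
    using e \<eta> d by (intro slab) auto
  also have "\<dots> = ennreal (\<kappa> * 144 * \<eta>\<^sup>2 / dist c c')"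
    by (simp add: d_def power2_eq_square mult.assoc)
  finally show "emeasure lborel (annulus c t \<eta> \<inter> annulus c' t' \<eta>) \<le> ennreal (\<kappa> * 144 * \<eta>\<^sup>2 / dist c c')" .
qed

section \<open>From the covering hypothesis to measures of neighbourhoods\<close>

text \<open>Compactness provides one finite cover, so the infimum is taken over a nonempty set of
  naturals and is a minimum.\<close>

lemma covering_number_attained:
  fixes T :: "'a::metric_space set"
  assumes "compact T" "\<epsilon> > 0"
  obtains F where "finite F" "card F = covering_number T \<epsilon>" "T \<subseteq> (\<Union>c\<in>F. ball c \<epsilon>)"
proof -
  let ?N = "{card F | F. finite F \<and> T \<subseteq> (\<Union>c\<in>F. ball c \<epsilon>)}"
  have "?N \<noteq> {}"
  proof (rule compactE_image[OF \<open>compact T\<close>, of T "\<lambda>c. ball c \<epsilon>"])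
    show "T \<subseteq> (\<Union>c\<in>T. ball c \<epsilon>)" using \<open>\<epsilon> > 0\<close> by auto
  qed (use \<open>\<epsilon> > 0\<close> in auto)
  then have "Inf ?N \<in> ?N" by (rule Inf_nat_def1)
  then show thesis using that unfolding covering_number_def by auto
qed

text \<open>Points of \<open>Y\<close> lie within O(\<rho>) of \<open>c - t *\<^sub>R u\<close> for
  some \<open>u\<close> in \<open>T\<close>. Covering \<open>T\<close> at a scale comparable to
  \<rho> costs a multiple of \<open>\<rho> powr (- (n - 1))\<close> balls, each becoming a ball of
  volume O(\<open>\<rho> ^ n\<close>), so the total is O(\<rho>). The radius \<open>s\<close> may
  vary with the point, as it does after linearization.\<close>

lemma emeasure_near_translates_le:
  fixes T :: "'a::euclidean_space set"
  assumes T: "compact T"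
    and cov: "\<And>\<delta>. 0 < \<delta> \<Longrightarrow> \<delta> < 1/2 \<Longrightarrow>
           real (covering_number T \<delta>) \<le> C * \<delta> powr (- (real DIM('a) - 1))"
  obtains D where "D \<ge> 0"
    "\<And>(c :: 'a) t \<rho> Y. t \<in> {1..2} \<Longrightarrow> 0 < \<rho> \<Longrightarrow> \<rho> \<le> 16 \<Longrightarrow>
       (\<And>x. x \<in> Y \<Longrightarrow> \<exists>u\<in>T. \<exists>s. \<bar>s - t\<bar> \<le> 3 * \<rho> \<and> dist (x + s *\<^sub>R u) c \<le> \<rho>) \<Longrightarrow>
       emeasure lborel Y \<le> ennreal (D * \<rho>)"
proof -
  obtain B where B: "B > 0" "\<And>u. u \<in> T \<Longrightarrow> norm u \<le> B"
    using compact_imp_bounded[OF T] by (auto simp: bounded_pos)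
  \<comment> \<open>The displacement found below is at most
    \<open>3 * \<rho> * B + 2 * \<sigma> + \<rho>\<close>, and \<open>2 * \<sigma>\<close> is much
    smaller than \<rho>.\<close>
  define M where "M = 2 + 3 * B"
  define n where "n = DIM('a)"
  define D where "D = \<bar>C\<bar> * unit_ball_vol n * M ^ n * 64 ^ (n - 1)"
  have n: "n \<ge> 1" by (simp add: n_def Suc_le_eq)
  have "emeasure lborel Y \<le> ennreal (D * \<rho>)"
    if t: "t \<in> {1..2}" and \<rho>: "0 < \<rho>" "\<rho> \<le> 16"
      and Y: "\<And>x. x \<in> Y \<Longrightarrow> \<exists>u\<in>T. \<exists>s. \<bar>s - t\<bar> \<le> 3 * \<rho> \<and> dist (x + s *\<^sub>R u) c \<le> \<rho>"
    for c :: 'a and t \<rho> Y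
  proof -
    \<comment> \<open>Since \<rho> may be as large as 16, dividing by 64 brings the scale below 1/2,
      where the covering hypothesis is available. The price is the factor
      \<open>64 ^ (n - 1)\<close> in \<open>D\<close>.\<close>
    define \<sigma> where "\<sigma> = \<rho> / 64"
    have \<sigma>: "0 < \<sigma>" "\<sigma> < 1/2" "\<rho> = 64 * \<sigma>" using \<rho> by (auto simp: \<sigma>_def)
    obtain F where F: "finite F" "card F = covering_number T \<sigma>" "T \<subseteq> (\<Union>p\<in>F. ball p \<sigma>)"
      using covering_number_attained[OF T \<sigma>(1)] by blast
    have "Y \<subseteq> (\<Union>p\<in>F. cball (c - t *\<^sub>R p) (M * \<rho>))"
    proof
      fix x assume "x \<in> Y"
      then obtain u s where u: "u \<in> T" "\<bar>s - t\<bar> \<le> 3 * \<rho>" "dist (x + s *\<^sub>R u) c \<le> \<rho>"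
        using Y by blast
      obtain p where p: "p \<in> F" "dist p u < \<sigma>" using u(1) F(3) by auto
      have decomp: "c - t *\<^sub>R p - x = (s - t) *\<^sub>R u + t *\<^sub>R (u - p) - (x + s *\<^sub>R u - c)"
        by (simp add: algebra_simps)
      have "norm (c - t *\<^sub>R p - x) \<le> norm ((s - t) *\<^sub>R u) + norm (t *\<^sub>R (u - p)) + norm (x + s *\<^sub>R u - c)"
        unfolding decomp using norm_triangle_ineq4[of "(s - t) *\<^sub>R u + t *\<^sub>R (u - p)" "x + s *\<^sub>R u - c"]
          norm_triangle_ineq[of "(s - t) *\<^sub>R u" "t *\<^sub>R (u - p)"] by linarith
      also have "norm ((s - t) *\<^sub>R u) \<le> 3 * \<rho> * B"
        using u(2) B(2)[OF u(1)] \<rho> by (auto intro!: mult_mono)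
      also have "norm (t *\<^sub>R (u - p)) \<le> 2 * \<sigma>"
        using t p(2) by (auto intro!: mult_mono simp: dist_norm norm_minus_commute)
      also have "norm (x + s *\<^sub>R u - c) \<le> \<rho>" using u(3) by (simp add: dist_norm)
      finally have "norm (c - t *\<^sub>R p - x) \<le> M * \<rho>"
        using \<sigma> by (simp add: M_def algebra_simps)
      then show "x \<in> (\<Union>p\<in>F. cball (c - t *\<^sub>R p) (M * \<rho>))"
        using p(1) by (auto simp: dist_norm)
    qed
    then have "emeasure lborel Y \<le> emeasure lborel (\<Union>p\<in>F. cball (c - t *\<^sub>R p) (M * \<rho>))"
      by (rule emeasure_mono) (use F(1) in auto)
    also have "\<dots> \<le> (\<Sum>p\<in>F. emeasure lborel (cball (c - t *\<^sub>R p) (M * \<rho>)))"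
      using F(1) by (intro emeasure_subadditive_finite) auto
    also have "\<dots> = ennreal (real (card F) * (unit_ball_vol n * (M * \<rho>) ^ n))"
      using \<rho> B by (simp add: emeasure_cball M_def n_def ennreal_mult ennreal_of_nat_eq_real_of_nat)
    also have "\<dots> \<le> ennreal (D * \<rho>)"
    proof (rule ennreal_leI)
      have "real (card F) * (unit_ball_vol n * (M * \<rho>) ^ n)
          \<le> (C * \<sigma> powr (- (real n - 1))) * (unit_ball_vol n * (M * \<rho>) ^ n)"
        using cov[OF \<sigma>(1,2)] F(2) \<rho> B by (intro mult_right_mono) (auto simp: n_def M_def)
      also have "\<dots> \<le> (\<bar>C\<bar> * \<sigma> powr (- (real n - 1))) * (unit_ball_vol n * (M * \<rho>) ^ n)"
        using \<rho> B by (intro mult_right_mono) (auto simp: M_def)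
      also have "\<dots> = \<bar>C\<bar> * unit_ball_vol n * M ^ n * (\<sigma> powr (- (real n - 1)) * \<rho> ^ n)"
        by (simp add: power_mult_distrib)
      also have "\<sigma> powr (- (real n - 1)) * \<rho> ^ n = 64 ^ n * (\<sigma> powr (1 - real n) * \<sigma> powr real n)"
        using \<sigma> by (simp add: power_mult_distrib powr_realpow)
      also have "\<dots> = 64 ^ n * \<sigma>"
        using \<sigma> by (simp add: powr_add[symmetric])
      also have "\<dots> = 64 ^ (n - 1) * \<rho>"
        using n by (cases n) (auto simp: \<sigma>(3))
      finally show "real (card F) * (unit_ball_vol n * (M * \<rho>) ^ n) \<le> D * \<rho>"
        by (simp add: D_def mult.assoc)
    qed
    finally show ?thesis .
  qed
  moreover have "D \<ge> 0" using B by (simp add: D_def M_def)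
  ultimately show thesis using that by blast
qed

section \<open>Square-integral bounds from the kernel of TT*\<close>

text \<open>For finite values this is \<open>(B * x - y)\<^sup>2 / B \<ge> 0\<close>; if a factor is
  infinite, so is the right side. The weight \<open>1 / B\<close> will cancel the constant produced
  by Schur's test.\<close>

lemma ennreal_weighted_AM_GM:
  fixes a b :: ennreal and B :: real
  assumes B: "B > 0"
  shows "2 * (a * b) \<le> ennreal B * a\<^sup>2 + ennreal (1 / B) * b\<^sup>2"
proof (cases "a = top \<or> b = top")
  case True
  then show ?thesis using B by (auto simp: ennreal_mult_top)
next
  case False
  then obtain x y where xy: "a = ennreal x" "b = ennreal y" "0 \<le> x" "0 \<le> y"
    by (metis ennreal_cases)
  have "0 \<le> (B * x - y)\<^sup>2 / B" using B by simp
  also have "(B * x - y)\<^sup>2 / B = B * x\<^sup>2 + 1 / B * y\<^sup>2 - 2 * (x * y)"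
    using B by (simp add: power2_diff field_simps power2_eq_square)
  finally have "2 * (x * y) \<le> B * x\<^sup>2 + 1 / B * y\<^sup>2" by simp
  then have "ennreal (2 * (x * y)) \<le> ennreal (B * x\<^sup>2 + 1 / B * y\<^sup>2)" by (rule ennreal_leI)
  moreover have "ennreal (y\<^sup>2 / B) = ennreal (1 / B) * ennreal (y\<^sup>2)"
    using B by (simp add: ennreal_mult[symmetric])
  ultimately show ?thesis
    using xy B by (simp add: ennreal_mult ennreal_power ennreal_plus)
qed

text \<open>Cutting off both in height and in space produces square-integrable functions that still
  recover the original one, even where it is infinite.\<close>

lemma SUP_inf_of_nat_indicator_ball:
  fixes x :: "'a::real_normed_vector" and y :: ennreal
  shows "(SUP N. inf y (of_nat N) * indicator (ball 0 (real N)) x) = y"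
proof (rule antisym)
  show "(SUP N. inf y (of_nat N) * indicator (ball 0 (real N)) x) \<le> y"
    by (intro SUP_least) (auto simp: indicator_def)
  obtain N0 where N0: "norm x < real N0" using reals_Archimedean2 by blast
  have "y = inf y (SUP N. of_nat N)" by (simp add: ennreal_SUP_of_nat_eq_top)
  also have "\<dots> = (SUP N. inf y (of_nat N))" by (rule inf_SUP)
  also have "\<dots> \<le> (SUP N. inf y (of_nat N) * indicator (ball 0 (real N)) x)"
  proof (rule SUP_mono)
    fix N
    \<comment> \<open>Passing to level \<open>max N N0\<close> puts \<open>x\<close> inside the
      ball, where the spatial cut-off has no effect.\<close>
    have "inf y (of_nat N) \<le> inf y (of_nat (max N N0))"
      by (intro inf_mono order_refl) (simp only: of_nat_le_iff max.cobounded1)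
    also have "\<dots> = inf y (of_nat (max N N0)) * indicator (ball 0 (real (max N N0))) x"
      using N0 by (auto simp: indicator_def)
    finally show "\<exists>M\<in>UNIV. inf y (of_nat N) \<le> inf y (of_nat M) * indicator (ball 0 (real M)) x"
      by blast
  qed
  finally show "y \<le> (SUP N. inf y (of_nat N) * indicator (ball 0 (real N)) x)" .
qed

text \<open>Pairing \<open>F = T g\<close> with its truncations \<open>h N\<close> keeps the term that is absorbed finite; Schur's test for
  the kernel of \<open>TT\<^sup>*\<close> reduces to \<open>2ab \<le> a\<^sup>2 + b\<^sup>2\<close> by symmetry.\<close>

lemma nn_integral_square_le_of_TT_star:
  fixes k :: "'a::euclidean_space \<Rightarrow> 'b::euclidean_space \<Rightarrow> ennreal" and g :: "'b \<Rightarrow> ennreal" and B :: real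
  assumes k [measurable]: "case_prod k \<in> borel_measurable (borel \<Otimes>\<^sub>M borel)"
    and g [measurable]: "g \<in> borel_measurable borel"
    and B: "B > 0"
    and kernel: "\<And>x. (\<integral>\<^sup>+ x'. \<integral>\<^sup>+ z. k x z * k x' z \<partial>lborel \<partial>lborel) \<le> ennreal B"
  shows "(\<integral>\<^sup>+ x. (\<integral>\<^sup>+ z. k x z * g z \<partial>lborel)\<^sup>2 \<partial>lborel) \<le> ennreal B * (\<integral>\<^sup>+ z. (g z)\<^sup>2 \<partial>lborel)"
proof -
  define F where "F = (\<lambda>x. \<integral>\<^sup>+ z. k x z * g z \<partial>lborel)"
  have [measurable]: "F \<in> borel_measurable borel" unfolding F_def by measurable
  define h where "h = (\<lambda>N x. inf (F x) (of_nat N) * indicator (ball 0 (real N)) x)"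
  have [measurable]: "ball (0::'a) (real N) \<in> sets borel" for N by simp
  have [measurable]: "h N \<in> borel_measurable borel" for N unfolding h_def inf_min by measurable
  have hF: "h N x \<le> F x" for N x by (auto simp: h_def indicator_def)
  let ?G = "\<integral>\<^sup>+ z. (g z)\<^sup>2 \<partial>lborel"
  have hFg: "(\<integral>\<^sup>+ x. h N x * F x \<partial>lborel) \<le> ennreal B * ?G" for N
  proof -
    let ?I = "\<integral>\<^sup>+ x. h N x * F x \<partial>lborel" and ?J = "\<integral>\<^sup>+ x. (h N x)\<^sup>2 \<partial>lborel"
    \<comment> \<open>\<open>H\<close> is the adjoint operator applied to \<open>h N\<close>: Fubini
      turns the pairing of \<open>h N\<close> with \<open>F\<close> into the pairing of
      \<open>g\<close> with \<open>H\<close>, and the square integral of \<open>H\<close> is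
      governed by the kernel \<Phi> of TT*.\<close>
    define H where "H = (\<lambda>z. \<integral>\<^sup>+ x. h N x * k x z \<partial>lborel)"
    have [measurable]: "H \<in> borel_measurable borel" unfolding H_def by measurable
    \<comment> \<open>Finiteness of \<open>?J\<close> is what the truncation is for: it licenses the
      cancellation further down.\<close>
    have "?J \<le> (\<integral>\<^sup>+ x. (of_nat N)\<^sup>2 * indicator (ball (0::'a) (real N)) x \<partial>lborel)"
      by (intro nn_integral_mono) (auto simp: h_def indicator_def intro!: power_mono_ennreal)
    also have "\<dots> = (of_nat N)\<^sup>2 * emeasure lborel (ball (0::'a) (real N))"
      by (rule nn_integral_cmult_indicator) simp
    also have "\<dots> < top"
      by (simp add: emeasure_ball ennreal_mult_less_top power_less_top_ennreal of_nat_less_top)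
    finally have J: "?J \<noteq> top" by simp
    have "?I = (\<integral>\<^sup>+ x. \<integral>\<^sup>+ z. h N x * (k x z * g z) \<partial>lborel \<partial>lborel)"
      unfolding F_def by (simp add: nn_integral_cmult)
    also have "\<dots> = (\<integral>\<^sup>+ z. \<integral>\<^sup>+ x. h N x * (k x z * g z) \<partial>lborel \<partial>lborel)"
      by (rule lborel_pair.Fubini') measurable
    also have "\<dots> = (\<integral>\<^sup>+ z. g z * H z \<partial>lborel)"
      unfolding H_def by (simp add: nn_integral_cmult[symmetric] mult_ac)
    finally have "2 * ?I = (\<integral>\<^sup>+ z. 2 * (g z * H z) \<partial>lborel)"
      by (simp add: nn_integral_cmult)
    also have "\<dots> \<le> (\<integral>\<^sup>+ z. ennreal B * (g z)\<^sup>2 + ennreal (1 / B) * (H z)\<^sup>2 \<partial>lborel)"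
      by (intro nn_integral_mono ennreal_weighted_AM_GM B)
    also have "\<dots> = ennreal B * ?G + ennreal (1 / B) * (\<integral>\<^sup>+ z. (H z)\<^sup>2 \<partial>lborel)"
      by (simp add: nn_integral_add nn_integral_cmult)
    finally have I: "2 * ?I \<le> ennreal B * ?G + ennreal (1 / B) * (\<integral>\<^sup>+ z. (H z)\<^sup>2 \<partial>lborel)" .
    define \<Phi> where "\<Phi> = (\<lambda>x x'. \<integral>\<^sup>+ z. k x z * k x' z \<partial>lborel)"
    have [measurable]: "case_prod \<Phi> \<in> borel_measurable (borel \<Otimes>\<^sub>M borel)" unfolding \<Phi>_def by measurable
    have \<Phi>_le: "(\<integral>\<^sup>+ x. \<integral>\<^sup>+ x'. (h N x)\<^sup>2 * \<Phi> x x' \<partial>lborel \<partial>lborel) \<le> ennreal B * ?J"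
    proof -
      have "(\<integral>\<^sup>+ x. \<integral>\<^sup>+ x'. (h N x)\<^sup>2 * \<Phi> x x' \<partial>lborel \<partial>lborel) = (\<integral>\<^sup>+ x. (h N x)\<^sup>2 * (\<integral>\<^sup>+ x'. \<Phi> x x' \<partial>lborel) \<partial>lborel)"
        by (simp add: nn_integral_cmult)
      also have "\<dots> \<le> (\<integral>\<^sup>+ x. (h N x)\<^sup>2 * ennreal B \<partial>lborel)"
        using kernel unfolding \<Phi>_def by (intro nn_integral_mono mult_left_mono) auto
      also have "\<dots> = ennreal B * ?J" by (subst nn_integral_multc) (simp_all add: mult.commute)
      finally show ?thesis .
    qed
    have \<Phi>_sym: "\<Phi> x x' = \<Phi> x' x" for x x' by (simp add: \<Phi>_def mult.commute)
    have "(\<integral>\<^sup>+ z. (H z)\<^sup>2 \<partial>lborel) = (\<integral>\<^sup>+ z. \<integral>\<^sup>+ x. \<integral>\<^sup>+ x'. (h N x * k x z) * (h N x' * k x' z) \<partial>lborel \<partial>lborel \<partial>lborel)"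
      unfolding H_def power2_eq_square by (simp add: nn_integral_cmult nn_integral_multc)
    also have "\<dots> = (\<integral>\<^sup>+ x. \<integral>\<^sup>+ z. \<integral>\<^sup>+ x'. (h N x * k x z) * (h N x' * k x' z) \<partial>lborel \<partial>lborel \<partial>lborel)"
      by (rule lborel_pair.Fubini') measurable
    also have "\<dots> = (\<integral>\<^sup>+ x. \<integral>\<^sup>+ x'. \<integral>\<^sup>+ z. (h N x * k x z) * (h N x' * k x' z) \<partial>lborel \<partial>lborel \<partial>lborel)"
      by (intro nn_integral_cong lborel_pair.Fubini') measurable
    also have "\<dots> = (\<integral>\<^sup>+ x. \<integral>\<^sup>+ x'. (h N x * h N x') * \<Phi> x x' \<partial>lborel \<partial>lborel)"
      unfolding \<Phi>_def by (simp add: nn_integral_cmult[symmetric] mult_ac)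
    finally have "2 * (\<integral>\<^sup>+ z. (H z)\<^sup>2 \<partial>lborel) = (\<integral>\<^sup>+ x. \<integral>\<^sup>+ x'. 2 * (h N x * h N x') * \<Phi> x x' \<partial>lborel \<partial>lborel)"
      by (simp add: nn_integral_cmult mult.assoc)
    also have "\<dots> \<le> (\<integral>\<^sup>+ x. \<integral>\<^sup>+ x'. (h N x)\<^sup>2 * \<Phi> x x' + (h N x')\<^sup>2 * \<Phi> x' x \<partial>lborel \<partial>lborel)"
    proof (intro nn_integral_mono)
      fix x x'
      have "2 * (h N x * h N x') * \<Phi> x x' \<le> ((h N x)\<^sup>2 + (h N x')\<^sup>2) * \<Phi> x x'"
        using ennreal_weighted_AM_GM[of 1 "h N x" "h N x'"] by (intro mult_right_mono) auto
      then show "2 * (h N x * h N x') * \<Phi> x x' \<le> (h N x)\<^sup>2 * \<Phi> x x' + (h N x')\<^sup>2 * \<Phi> x' x"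
        by (simp add: distrib_right \<Phi>_sym[of x' x])
    qed
    also have "\<dots> = (\<integral>\<^sup>+ x. \<integral>\<^sup>+ x'. (h N x)\<^sup>2 * \<Phi> x x' \<partial>lborel \<partial>lborel)
        + (\<integral>\<^sup>+ x. \<integral>\<^sup>+ x'. (h N x')\<^sup>2 * \<Phi> x' x \<partial>lborel \<partial>lborel)"
      by (simp add: nn_integral_add)
    also have "(\<integral>\<^sup>+ x. \<integral>\<^sup>+ x'. (h N x')\<^sup>2 * \<Phi> x' x \<partial>lborel \<partial>lborel) = (\<integral>\<^sup>+ x'. \<integral>\<^sup>+ x. (h N x')\<^sup>2 * \<Phi> x' x \<partial>lborel \<partial>lborel)"
      by (rule lborel_pair.Fubini') measurable
    also have "(\<integral>\<^sup>+ x. \<integral>\<^sup>+ x'. (h N x)\<^sup>2 * \<Phi> x x' \<partial>lborel \<partial>lborel) + \<dots> \<le> 2 * (ennreal B * ?J)"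
      using \<Phi>_le by (simp add: mult_2 add_mono)
    finally have "(\<integral>\<^sup>+ z. (H z)\<^sup>2 \<partial>lborel) \<le> ennreal B * ?J"
      by (simp add: ennreal_mult_le_mult_iff)
    then have "ennreal (1 / B) * (\<integral>\<^sup>+ z. (H z)\<^sup>2 \<partial>lborel) \<le> ennreal (1 / B) * (ennreal B * ?J)"
      by (intro mult_left_mono) auto
    also have "\<dots> = ?J"
      using B by (simp add: mult.assoc[symmetric] ennreal_mult[symmetric])
    finally have "ennreal (1 / B) * (\<integral>\<^sup>+ z. (H z)\<^sup>2 \<partial>lborel) \<le> ?J" .
    from order_trans[OF I add_left_mono[OF this]] have IJ: "2 * ?I \<le> ennreal B * ?G + ?J" .
    have JI: "?J \<le> ?I"
      unfolding power2_eq_square by (intro nn_integral_mono mult_left_mono hF) auto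
    \<comment> \<open>Absorption: \<open>?J \<le> ?I\<close> and \<open>IJ\<close> give
      \<open>2 * ?J \<le> ?J + B * ?G\<close>. Cancelling the finite \<open>?J\<close> bounds it by
      \<open>B * ?G\<close>, and feeding this back into \<open>IJ\<close> bounds
      \<open>?I\<close>.\<close>
    have "?J + ?J \<le> 2 * ?I"
      unfolding mult_2 by (intro add_mono JI)
    also note IJ
    finally have "?J + ?J \<le> ?J + ennreal B * ?G" by (simp only: add.commute)
    then have "?J \<le> ennreal B * ?G" using J by (simp add: ennreal_add_left_cancel_le)
    from order_trans[OF IJ add_left_mono[OF this]] have "2 * ?I \<le> 2 * (ennreal B * ?G)"
      by (simp only: mult_2)
    then show ?thesis by (simp add: ennreal_mult_le_mult_iff)
  qed
  have "(\<integral>\<^sup>+ x. (F x)\<^sup>2 \<partial>lborel) = (\<integral>\<^sup>+ x. (SUP N. h N x * F x) \<partial>lborel)"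
    by (simp add: SUP_mult_right_ennreal[symmetric] h_def SUP_inf_of_nat_indicator_ball power2_eq_square)
  also have "\<dots> = (SUP N. \<integral>\<^sup>+ x. h N x * F x \<partial>lborel)"
  proof (rule nn_integral_monotone_convergence_SUP)
    show "incseq (\<lambda>N x. h N x * F x)"
      unfolding incseq_def le_fun_def h_def
      by (intro allI impI mult_mono inf_mono) (auto simp: indicator_def)
  qed measurable
  also have "\<dots> \<le> ennreal B * ?G" by (intro SUP_least hFg)
  finally show ?thesis unfolding F_def .
qed

section \<open>Integrated overlap of annuli, summed over dyadic distances\<close>

lemma annulus_Int_nonemptyD:
  assumes "z \<in> annulus c t \<eta> \<inter> annulus c' t' \<eta>"
  shows "\<bar>t' - t\<bar> \<le> dist c c' + 2 * \<eta>" "dist c c' < t + t' + 2 * \<eta>"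
proof -
  have "dist z c \<le> dist z c' + dist c c'" "dist z c' \<le> dist z c + dist c c'" "dist c c' \<le> dist z c + dist z c'"
    by metric+
  then show "\<bar>t' - t\<bar> \<le> dist c c' + 2 * \<eta>" "dist c c' < t + t' + 2 * \<eta>"
    using assms by (auto simp: annulus_def)
qed

text \<open>At center distance about \<open>2 ^ k * \<eta>\<close> the overlap is
  O(\<open>\<eta> / 2 ^ k\<close>), while the set of such \<open>x\<close> has measure
  O(\<open>2 ^ k * \<eta>\<close>). The product is O(\<open>\<eta>\<^sup>2\<close>) at every scale,
  and the number \<open>K + 1\<close> of scales becomes the logarithm. The lower bound on
  \<open>2 ^ K * \<eta>\<close> makes the scales exhaust all distances at which annuli can meet; the
  upper bound keeps \<rho> within the range of the neighbourhood estimate.\<close>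

lemma annulus_overlap_integral_le:
  fixes T :: "'a::euclidean_space set"
  assumes dim: "DIM('a) \<ge> 3" and T: "compact T"
    and cov: "\<And>\<delta>. 0 < \<delta> \<Longrightarrow> \<delta> < 1/2 \<Longrightarrow>
           real (covering_number T \<delta>) \<le> C * \<delta> powr (- (real DIM('a) - 1))"
  obtains G where "G > 0"
    "\<And>(\<phi> :: 'a \<Rightarrow> 'a) \<tau> c t \<eta> K. \<phi> \<in> borel_measurable borel \<Longrightarrow> \<tau> \<in> borel_measurable borel \<Longrightarrow>
       (\<And>x. \<tau> x \<in> {1..2} \<and> (\<exists>u\<in>T. \<phi> x = x + \<tau> x *\<^sub>R u)) \<Longrightarrow> t \<in> {1..2} \<Longrightarrow>
       0 < \<eta> \<Longrightarrow> \<eta> \<le> 2 \<Longrightarrow> 8 \<le> 2 ^ K * \<eta> \<Longrightarrow> 2 ^ K * \<eta> \<le> 16 \<Longrightarrow>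
       (\<integral>\<^sup>+ x. emeasure lborel (annulus c t \<eta> \<inter> annulus (\<phi> x) (\<tau> x) \<eta>) \<partial>lborel) \<le> ennreal (G * \<eta>\<^sup>2 * (real K + 1))"
proof -
  obtain A where A: "A > 0"
    "\<And>(c :: 'a) t \<eta>. t \<in> {1..2} \<Longrightarrow> 0 < \<eta> \<Longrightarrow> \<eta> \<le> 2 \<Longrightarrow> emeasure lborel (annulus c t \<eta>) \<le> ennreal (A * \<eta>)"
    "\<And>(c :: 'a) c' t t' \<eta>. c \<noteq> c' \<Longrightarrow> t \<in> {1..2} \<Longrightarrow> t' \<in> {1..2} \<Longrightarrow> 0 < \<eta> \<Longrightarrow> \<eta> \<le> 2 \<Longrightarrow>
       emeasure lborel (annulus c t \<eta> \<inter> annulus c' t' \<eta>) \<le> ennreal (A * \<eta>\<^sup>2 / dist c c')"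
    using emeasure_annulus_bounds[OF dim] by blast
  obtain D where D: "D \<ge> 0"
    "\<And>(c :: 'a) t \<rho> Y. t \<in> {1..2} \<Longrightarrow> 0 < \<rho> \<Longrightarrow> \<rho> \<le> 16 \<Longrightarrow>
       (\<And>x. x \<in> Y \<Longrightarrow> \<exists>u\<in>T. \<exists>s. \<bar>s - t\<bar> \<le> 3 * \<rho> \<and> dist (x + s *\<^sub>R u) c \<le> \<rho>) \<Longrightarrow>
       emeasure lborel Y \<le> ennreal (D * \<rho>)"
    using emeasure_near_translates_le[OF T cov] by blast
  have "(\<integral>\<^sup>+ x. emeasure lborel (annulus c t \<eta> \<inter> annulus (\<phi> x) (\<tau> x) \<eta>) \<partial>lborel) \<le> ennreal ((2 * A * (D + 1)) * \<eta>\<^sup>2 * (real K + 1))"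
    if [measurable]: "\<phi> \<in> borel_measurable borel" "\<tau> \<in> borel_measurable borel"
      and sel: "\<And>x. \<tau> x \<in> {1..2} \<and> (\<exists>u\<in>T. \<phi> x = x + \<tau> x *\<^sub>R u)"
      and t: "t \<in> {1..2}" and \<eta>: "0 < \<eta>" "\<eta> \<le> 2" and K: "8 \<le> 2 ^ K * \<eta>" "2 ^ K * \<eta> \<le> 16"
    for \<phi> :: "'a \<Rightarrow> 'a" and \<tau> c t \<eta> K
  proof -
    \<comment> \<open>If the annuli meet, the radii differ by at most \<open>d + 2 * \<eta>\<close>;
      with \<open>d\<close> and \<eta> both at most \<open>2 ^ k * \<eta>\<close> this gives the
      factor 3.\<close>
    define Y where "Y = (\<lambda>k::nat. {x. dist c (\<phi> x) \<le> 2 ^ k * \<eta> \<and> \<bar>\<tau> x - t\<bar> \<le> 3 * (2 ^ k * \<eta>)})"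
    have [measurable]: "Y k \<in> sets borel" for k unfolding Y_def by measurable
    have Y_le: "emeasure lborel (Y k) \<le> ennreal (D * (2 ^ k * \<eta>))" if "k \<le> K" for k
    proof (rule D(2)[OF t])
      show "0 < 2 ^ k * \<eta>" using \<eta> by simp
      have "(2::real) ^ k * \<eta> \<le> 2 ^ K * \<eta>" using that \<eta> by (intro mult_right_mono power_increasing) auto
      then show "2 ^ k * \<eta> \<le> 16" using K by simp
      fix x assume "x \<in> Y k"
      moreover obtain u where "u \<in> T" "\<phi> x = x + \<tau> x *\<^sub>R u" using sel by blast
      ultimately show "\<exists>u\<in>T. \<exists>s. \<bar>s - t\<bar> \<le> 3 * (2 ^ k * \<eta>) \<and> dist (x + s *\<^sub>R u) c \<le> 2 ^ k * \<eta>"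
        by (auto simp: Y_def dist_commute intro!: bexI[of _ u] exI[of _ "\<tau> x"])
    qed
    have overlap: "emeasure lborel (annulus c t \<eta> \<inter> annulus (\<phi> x) (\<tau> x) \<eta>)
        \<le> (\<Sum>k\<le>K. ennreal (2 * A * \<eta> / 2 ^ k) * indicator (Y k) x)" for x
    proof (cases "annulus c t \<eta> \<inter> annulus (\<phi> x) (\<tau> x) \<eta> = {}")
      case False
      define d where "d = dist c (\<phi> x)"
      have \<tau>: "\<tau> x \<in> {1..2}" using sel by blast
      from False have d: "\<bar>\<tau> x - t\<bar> \<le> d + 2 * \<eta>" "d \<le> 8"
        using annulus_Int_nonemptyD[of _ c t \<eta> "\<phi> x" "\<tau> x"] \<tau> t \<eta> unfolding d_def by fastforce+
      \<comment> \<open>Minimality gives \<open>d > 2 ^ (k - 1) * \<eta>\<close> when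
        \<open>k > 0\<close>, so the two-annulus bound applies with a loss of 2. For
        \<open>k = 0\<close> the centers may coincide, and the volume of one annulus is used
        instead.\<close>
      define k where "k = (LEAST k. d \<le> 2 ^ k * \<eta>)"
      have dK: "d \<le> 2 ^ K * \<eta>" using d(2) K(1) by simp
      have k: "d \<le> 2 ^ k * \<eta>" "k \<le> K"
        unfolding k_def using dK by (rule LeastI, rule Least_le)
      have "\<eta> \<le> 2 ^ k * \<eta>" using \<eta> by simp
      then have xY: "x \<in> Y k" using k(1) d(1) by (simp add: Y_def d_def)
      have "emeasure lborel (annulus c t \<eta> \<inter> annulus (\<phi> x) (\<tau> x) \<eta>) \<le> ennreal (2 * A * \<eta> / 2 ^ k)"
      proof (cases k)
        case 0
        have "emeasure lborel (annulus c t \<eta> \<inter> annulus (\<phi> x) (\<tau> x) \<eta>) \<le> emeasure lborel (annulus c t \<eta>)"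
          by (intro emeasure_mono) auto
        also have "\<dots> \<le> ennreal (A * \<eta>)" by (rule A(2)[OF t \<eta>])
        also have "\<dots> \<le> ennreal (2 * A * \<eta> / 2 ^ k)" using 0 A(1) \<eta> by (intro ennreal_leI) simp
        finally show ?thesis .
      next
        case (Suc j)
        have "\<not> d \<le> 2 ^ j * \<eta>"
          using not_less_Least[of j "\<lambda>k. d \<le> 2 ^ k * \<eta>"] Suc unfolding k_def by simp
        then have dj: "2 ^ j * \<eta> < d" by simp
        moreover have "0 < 2 ^ j * \<eta>" using \<eta> by simp
        ultimately have d0: "0 < d" by linarith
        then have "c \<noteq> \<phi> x" by (auto simp: d_def)
        from A(3)[OF this t \<tau> \<eta>]
        have "emeasure lborel (annulus c t \<eta> \<inter> annulus (\<phi> x) (\<tau> x) \<eta>) \<le> ennreal (A * \<eta>\<^sup>2 / d)"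
          unfolding d_def .
        also have "A * \<eta>\<^sup>2 / d \<le> A * \<eta>\<^sup>2 / (2 ^ j * \<eta>)"
          using dj A(1) \<eta> d0 by (intro divide_left_mono) auto
        also have "\<dots> = 2 * A * \<eta> / 2 ^ k"
          using \<eta> by (simp add: Suc power2_eq_square)
        finally show ?thesis by (simp add: ennreal_leI)
      qed
      also have "\<dots> = ennreal (2 * A * \<eta> / 2 ^ k) * indicator (Y k) x" using xY by simp
      also have "\<dots> \<le> (\<Sum>k\<le>K. ennreal (2 * A * \<eta> / 2 ^ k) * indicator (Y k) x)"
        using k(2) by (intro member_le_sum) auto
      finally show ?thesis .
    qed simp
    have "(\<integral>\<^sup>+ x. emeasure lborel (annulus c t \<eta> \<inter> annulus (\<phi> x) (\<tau> x) \<eta>) \<partial>lborel)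
        \<le> (\<integral>\<^sup>+ x. (\<Sum>k\<le>K. ennreal (2 * A * \<eta> / 2 ^ k) * indicator (Y k) x) \<partial>lborel)"
      by (intro nn_integral_mono overlap)
    also have "\<dots> = (\<Sum>k\<le>K. ennreal (2 * A * \<eta> / 2 ^ k) * emeasure lborel (Y k))"
      by (subst nn_integral_sum, simp, intro sum.cong refl nn_integral_cmult_indicator, simp)
    also have "\<dots> \<le> (\<Sum>k\<le>K. ennreal (2 * A * (D + 1) * \<eta>\<^sup>2))"
    proof (rule sum_mono)
      fix k assume "k \<in> {..K}"
      then have "ennreal (2 * A * \<eta> / 2 ^ k) * emeasure lborel (Y k)
          \<le> ennreal (2 * A * \<eta> / 2 ^ k) * ennreal (D * (2 ^ k * \<eta>))"
        using Y_le by (intro mult_left_mono) auto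
      also have "\<dots> = ennreal (2 * A * D * \<eta>\<^sup>2)"
        using A(1) D(1) \<eta> by (simp add: ennreal_mult[symmetric] power2_eq_square)
      \<comment> \<open>\<open>D\<close> may be zero, whereas \<open>G\<close> has to be positive
        for the later application of the TT* bound.\<close>
      also have "\<dots> \<le> ennreal (2 * A * (D + 1) * \<eta>\<^sup>2)"
        using A(1) by (intro ennreal_leI mult_right_mono mult_left_mono) auto
      finally show "ennreal (2 * A * \<eta> / 2 ^ k) * emeasure lborel (Y k) \<le> ennreal (2 * A * (D + 1) * \<eta>\<^sup>2)" .
    qed
    also have "\<dots> = ennreal ((2 * A * (D + 1)) * \<eta>\<^sup>2 * (real K + 1))"
      using A(1) D(1) by (subst sum_ennreal) (auto simp: algebra_simps)
    finally show ?thesis .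
  qed
  moreover have "2 * A * (D + 1) > 0" using A(1) D(1) by simp
  ultimately show thesis using that by blast
qed

section \<open>Number of scales and measurable selection\<close>

text \<open>Choose \<open>2 ^ K\<close> between \<open>2 / \<delta>\<close> and
  \<open>4 / \<delta>\<close>. As \<open>l = log 2 (1 / \<delta>)\<close> is at least 1, the
  additive constants are absorbed by \<open>K + 1 \<le> l + 3 \<le> 4 * l\<close>. The quantity
  \<open>4 * \<delta>\<close> is the half-thickness of the annuli that replace the sphere
  neighbourhoods.\<close>

lemma dyadic_scale_exists:
  assumes "0 < \<delta>" "\<delta> < 1/2"
  obtains K :: nat where "8 \<le> 2 ^ K * (4 * \<delta>)" "2 ^ K * (4 * \<delta>) \<le> 16" "real K + 1 \<le> 4 / ln 2 * ln (1 / \<delta>)"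
proof
  define l where "l = log 2 (1 / \<delta>)"
  have \<delta>: "2 powr l = 1 / \<delta>" unfolding l_def using assms by (intro powr_log_cancel) auto
  have "log 2 2 \<le> l" unfolding l_def using assms by (intro log_mono) (auto simp: field_simps)
  then have l: "l \<ge> 1" by simp
  define K where "K = nat \<lceil>l\<rceil> + 1"
  have K: "l + 1 \<le> real K" "real K \<le> l + 2" using l unfolding K_def by linarith+
  have "2 ^ K = 2 powr real K" by (simp add: powr_realpow)
  moreover have "2 powr (l + 1) \<le> 2 powr real K" "2 powr real K \<le> 2 powr (l + 2)"
    using K by (intro powr_mono; simp)+
  moreover have "2 powr (l + 1) = 2 / \<delta>" "2 powr (l + 2) = 4 / \<delta>" by (simp_all add: powr_add \<delta>)
  ultimately have "2 / \<delta> \<le> 2 ^ K" "2 ^ K \<le> 4 / \<delta>" by simp_all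
  then show "8 \<le> 2 ^ K * (4 * \<delta>)" "2 ^ K * (4 * \<delta>) \<le> 16"
    using assms by (simp_all add: field_simps)
  show "real K + 1 \<le> 4 / ln 2 * ln (1 / \<delta>)"
  proof -
    have "real K + 1 \<le> 4 * l" using K l by linarith
    then show ?thesis by (simp add: l_def log_def)
  qed
qed

text \<open>This linearizes a finite maximum. Indices are inserted one at a time; the induction also
  carries measurability of the selected value, since the next selection compares that value with
  \<open>a j\<close>.\<close>

lemma measurable_maximizer:
  fixes a :: "'b \<Rightarrow> 'c \<Rightarrow> ennreal"
  assumes "finite J" "J \<noteq> {}" and "\<And>j. j \<in> J \<Longrightarrow> a j \<in> borel_measurable M"
  obtains s where "s \<in> M \<rightarrow>\<^sub>M count_space UNIV" "\<And>x. s x \<in> J" "\<And>x j. j \<in> J \<Longrightarrow> a j x \<le> a (s x) x"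
proof -
  have "\<exists>s \<in> M \<rightarrow>\<^sub>M count_space UNIV. range s \<subseteq> J \<and> (\<lambda>x. a (s x) x) \<in> borel_measurable M \<and> (\<forall>x. \<forall>j\<in>J. a j x \<le> a (s x) x)"
    using assms
  proof (induction J rule: finite_ne_induct)
    case (singleton j)
    then show ?case by (intro bexI[of _ "\<lambda>_. j"]) auto
  next
    case (insert j J)
    have "\<exists>s \<in> M \<rightarrow>\<^sub>M count_space UNIV. range s \<subseteq> J \<and> (\<lambda>x. a (s x) x) \<in> borel_measurable M \<and> (\<forall>x. \<forall>j\<in>J. a j x \<le> a (s x) x)"
      by (rule insert.IH) (rule insert.prems, simp)
    then obtain s where s [measurable]: "s \<in> M \<rightarrow>\<^sub>M count_space UNIV" "(\<lambda>x. a (s x) x) \<in> borel_measurable M"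
      and sJ: "range s \<subseteq> J" "\<forall>x. \<forall>i\<in>J. a i x \<le> a (s x) x"
      by blast
    have [measurable]: "a j \<in> borel_measurable M" using insert.prems by simp
    define s' where "s' = (\<lambda>x. if a (s x) x < a j x then j else s x)"
    have val: "a (s' x) x = max (a (s x) x) (a j x)" for x by (auto simp: s'_def max_def not_le dest: less_imp_not_less)
    have "s' \<in> M \<rightarrow>\<^sub>M count_space UNIV" unfolding s'_def by measurable
    moreover have "(\<lambda>x. a (s' x) x) \<in> borel_measurable M" unfolding val by measurable
    moreover have "range s' \<subseteq> insert j J" using sJ(1) by (auto simp: s'_def)
    moreover have "\<forall>x. \<forall>i\<in>insert j J. a i x \<le> a (s' x) x"
      unfolding val using sJ(2) by (auto simp: le_max_iff_disj)
    ultimately show ?case by blast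
  qed
  with that show thesis by blast
qed

section \<open>Comparison of spherical averages with annuli\<close>

lemma sphere_nbhd_subset_annulus: "(sphere_nbhd \<delta> :: 'a::euclidean_space set) \<subseteq> annulus 0 1 \<delta>"
proof
  fix y :: 'a assume "y \<in> sphere_nbhd \<delta>"
  then have "infdist y (sphere 0 1) < \<delta>" by (simp add: sphere_nbhd_def)
  moreover have "\<bar>norm y - 1\<bar> \<le> infdist y (sphere 0 1)"
  proof -
    have "\<bar>norm y - 1\<bar> \<le> dist y a" if "a \<in> sphere 0 1" for a
      using norm_triangle_ineq3[of y a] that by (simp add: dist_norm)
    then show ?thesis by (subst infdist_notempty) (auto intro!: cINF_greatest)
  qed
  ultimately show "y \<in> annulus 0 1 \<delta>" by (simp add: annulus_def)
qed

text \<open>The outer half of the shell is enough: its volume is the unit ball volume times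
  \<open>(1 + \<delta>) ^ n - 1\<close>, which Bernoulli's inequality bounds below by
  \<open>n * \<delta>\<close>.\<close>

lemma measure_sphere_nbhd_ge:
  assumes "0 < \<delta>"
  shows "unit_ball_vol (DIM('a::euclidean_space)) * \<delta> \<le> measure lebesgue (sphere_nbhd \<delta> :: 'a set)"
proof -
  let ?n = "DIM('a)" let ?S = "sphere_nbhd \<delta> :: 'a set"
  have sub: "ball 0 (1 + \<delta>) - cball 0 1 \<subseteq> ?S"
  proof
    fix y :: 'a assume y: "y \<in> ball 0 (1 + \<delta>) - cball 0 1"
    then have n: "1 < norm y" "norm y < 1 + \<delta>" by auto
    have "0 < norm y" using n by linarith
    then have "1 / norm y \<le> 1" using divide_le_eq_1_pos n(1)[THEN less_imp_le] by blast
    have "y - y /\<^sub>R norm y = (1 - 1 / norm y) *\<^sub>R y" by (simp add: algebra_simps divide_inverse)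
    then have "dist y (y /\<^sub>R norm y) = \<bar>1 - 1 / norm y\<bar> * norm y" by (simp add: dist_norm)
    also have "\<bar>1 - 1 / norm y\<bar> = 1 - 1 / norm y" using \<open>1 / norm y \<le> 1\<close> by linarith
    also have "(1 - 1 / norm y) * norm y = norm y - 1" using \<open>0 < norm y\<close> by (simp add: left_diff_distrib)
    finally have "dist y (y /\<^sub>R norm y) < \<delta>" using n by simp
    moreover have "y /\<^sub>R norm y \<in> sphere 0 1" using \<open>0 < norm y\<close> by simp
    ultimately show "y \<in> ?S"
      unfolding sphere_nbhd_def using infdist_le[of "y /\<^sub>R norm y" "sphere 0 1" y] by simp
  qed
  have "open ?S"
    unfolding sphere_nbhd_def by (intro open_Collect_less continuous_intros)
  have "?S \<subseteq> ball 0 (1 + \<delta>)"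
    using sphere_nbhd_subset_annulus[of \<delta>] by (auto simp: annulus_def)
  then have "bounded ?S" using bounded_ball bounded_subset by blast
  with \<open>open ?S\<close> have S: "?S \<in> lmeasurable" by (simp add: lmeasurable_open)
  have "unit_ball_vol ?n * \<delta> \<le> unit_ball_vol ?n * ((1 + \<delta>) ^ ?n - 1)"
  proof (rule mult_left_mono)
    have "\<delta> \<le> real ?n * \<delta>" using assms by (simp add: Suc_le_eq)
    also have "\<dots> \<le> (1 + \<delta>) ^ ?n - 1" using Bernoulli_inequality[of \<delta> ?n] assms by simp
    finally show "\<delta> \<le> (1 + \<delta>) ^ ?n - 1" .
  qed simp
  also have "\<dots> = measure lebesgue (ball (0::'a) (1 + \<delta>)) - measure lebesgue (cball (0::'a) 1)"
    using assms by (simp add: content_ball content_cball algebra_simps)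
  also have "\<dots> = measure lebesgue (ball (0::'a) (1 + \<delta>) - cball 0 1)"
    using assms by (intro measurable_measure_Diff[symmetric]) auto
  also have "\<dots> \<le> measure lebesgue ?S"
    using sub S by (intro measure_mono_fmeasurable) auto
  finally show ?thesis .
qed

lemma nn_integral_lborel_dilate_le:
  fixes k :: "'a::euclidean_space \<Rightarrow> ennreal"
  assumes [measurable]: "k \<in> borel_measurable borel" and t: "t \<ge> 1"
  shows "(\<integral>\<^sup>+ y. k (c + t *\<^sub>R y) \<partial>lborel) \<le> (\<integral>\<^sup>+ z. k z \<partial>lborel)"
proof -
  have "(\<integral>\<^sup>+ z. k z \<partial>lborel) = (\<integral>\<^sup>+ y. ennreal (t ^ DIM('a)) * k (c + t *\<^sub>R y) \<partial>lborel)"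
    using t by (subst lborel_affine[of t c]) (simp_all add: nn_integral_density nn_integral_distr)
  moreover have "k (c + t *\<^sub>R y) \<le> ennreal (t ^ DIM('a)) * k (c + t *\<^sub>R y)" for y
    using mult_right_mono[of 1 "ennreal (t ^ DIM('a))" "k (c + t *\<^sub>R y)"] t by simp
  ultimately show ?thesis by (simp add: nn_integral_mono)
qed

text \<open>Dilating by \<open>t \<le> 2\<close> widens the shell to \<open>2 * \<delta>\<close>;
  moving the center from \<open>t *\<^sub>R u\<close> to \<open>v\<close> and the radius from
  \<open>t\<close> to \<open>t'\<close> costs \<delta> each, for a total of
  \<open>4 * \<delta>\<close>. This slack is what lets a finite net of parameters control the whole
  supremum.\<close>

lemma sphere_average_le_annulus:
  fixes f :: "'a::euclidean_space \<Rightarrow> real"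
  assumes fg: "\<And>z. ennreal \<bar>f z\<bar> \<le> g z" and [measurable]: "g \<in> borel_measurable borel"
    and \<delta>: "0 < \<delta>" and t: "t \<in> {1..2}" and v: "dist v (t *\<^sub>R u) \<le> \<delta>" and t': "dist t' t \<le> \<delta>"
  shows "ennreal (\<bar>set_lebesgue_integral lebesgue (sphere_nbhd \<delta>) (\<lambda>y. f (x + t *\<^sub>R (u + y)))\<bar>
      / measure lebesgue (sphere_nbhd \<delta> :: 'a set))
    \<le> ennreal (1 / (unit_ball_vol (DIM('a)) * \<delta>)) * (\<integral>\<^sup>+ z. indicator (annulus (x + v) t' (4 * \<delta>)) z * g z \<partial>lborel)"
proof -
  let ?S = "sphere_nbhd \<delta> :: 'a set"
  let ?I = "set_lebesgue_integral lebesgue ?S (\<lambda>y. f (x + t *\<^sub>R (u + y)))"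
  let ?k = "\<lambda>z. indicator (annulus (x + v) t' (4 * \<delta>)) z * g z"
  let ?\<omega> = "unit_ball_vol (DIM('a))"
  have k [measurable]: "?k \<in> borel_measurable borel" by measurable
  have incl: "x + t *\<^sub>R u + t *\<^sub>R y \<in> annulus (x + v) t' (4 * \<delta>)" if "y \<in> ?S" for y
  proof -
    have "\<bar>norm y - 1\<bar> < \<delta>"
      using sphere_nbhd_subset_annulus[of \<delta>] that by (auto simp: annulus_def)
    then have "2 * \<bar>norm y - 1\<bar> < 2 * \<delta>" by simp
    moreover have "t * \<bar>norm y - 1\<bar> \<le> 2 * \<bar>norm y - 1\<bar>" using t by (intro mult_right_mono) auto
    ultimately have "t * \<bar>norm y - 1\<bar> < 2 * \<delta>" by (rule le_less_trans[rotated])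
    moreover have "norm (t *\<^sub>R y) - t = t * (norm y - 1)" using t by (simp add: algebra_simps)
    ultimately have 1: "\<bar>norm (t *\<^sub>R y) - t\<bar> < 2 * \<delta>" using t by (simp add: abs_mult)
    have "\<bar>norm (t *\<^sub>R y - (v - t *\<^sub>R u)) - norm (t *\<^sub>R y)\<bar> \<le> norm (v - t *\<^sub>R u)"
      using norm_triangle_ineq3[of "t *\<^sub>R y - (v - t *\<^sub>R u)" "t *\<^sub>R y"] by (simp add: norm_minus_commute)
    then have "\<bar>norm (t *\<^sub>R y - (v - t *\<^sub>R u)) - norm (t *\<^sub>R y)\<bar> \<le> \<delta>"
      using v by (simp add: dist_norm)
    moreover have "dist (x + t *\<^sub>R u + t *\<^sub>R y) (x + v) = norm (t *\<^sub>R y - (v - t *\<^sub>R u))"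
      by (simp add: dist_norm algebra_simps)
    ultimately show ?thesis using 1 t' by (simp add: annulus_def dist_real_def)
  qed
  have "ennreal \<bar>?I\<bar> \<le> (\<integral>\<^sup>+ y. ennreal (norm (indicator ?S y *\<^sub>R f (x + t *\<^sub>R (u + y)))) \<partial>lebesgue)"
  proof (cases "integrable lebesgue (\<lambda>y. indicator ?S y *\<^sub>R f (x + t *\<^sub>R (u + y)))")
    case True
    then show ?thesis
      unfolding set_lebesgue_integral_def real_norm_def[symmetric] by (rule integral_norm_bound_ennreal)
  next
    \<comment> \<open>The Bochner integral of a non-integrable function is 0 by convention, so the
      bound is trivial here.\<close>
    case False
    then show ?thesis by (simp add: set_lebesgue_integral_def not_integrable_integral_eq)
  qed
  also have "\<dots> \<le> (\<integral>\<^sup>+ y. ?k (x + t *\<^sub>R u + t *\<^sub>R y) \<partial>lebesgue)"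
  proof (rule nn_integral_mono)
    fix y :: 'a
    show "ennreal (norm (indicator ?S y *\<^sub>R f (x + t *\<^sub>R (u + y)))) \<le> ?k (x + t *\<^sub>R u + t *\<^sub>R y)"
    proof (cases "y \<in> ?S")
      case True
      then show ?thesis
        using incl[OF True] fg[of "x + t *\<^sub>R u + t *\<^sub>R y"] by (simp add: algebra_simps)
    qed simp
  qed
  also have "\<dots> = (\<integral>\<^sup>+ y. ?k (x + t *\<^sub>R u + t *\<^sub>R y) \<partial>lborel)"
    by (rule nn_integral_completion)
  also have "\<dots> \<le> (\<integral>\<^sup>+ z. ?k z \<partial>lborel)"
    using t by (intro nn_integral_lborel_dilate_le[OF k]) auto
  finally have I: "ennreal \<bar>?I\<bar> \<le> (\<integral>\<^sup>+ z. ?k z \<partial>lborel)" .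
  have \<omega>: "0 < ?\<omega> * \<delta>" using \<delta> by simp
  note ge = measure_sphere_nbhd_ge[OF \<delta>, where 'a = 'a]
  have "\<bar>?I\<bar> / measure lebesgue ?S \<le> \<bar>?I\<bar> / (?\<omega> * \<delta>)"
    by (rule divide_left_mono[OF ge abs_ge_zero mult_pos_pos[OF less_le_trans[OF \<omega> ge] \<omega>]])
  then have "ennreal (\<bar>?I\<bar> / measure lebesgue ?S) \<le> ennreal (1 / (?\<omega> * \<delta>)) * ennreal \<bar>?I\<bar>"
    using \<omega> by (simp add: ennreal_mult[symmetric] ennreal_leI)
  also have "\<dots> \<le> ennreal (1 / (?\<omega> * \<delta>)) * (\<integral>\<^sup>+ z. ?k z \<partial>lborel)"
    using I by (intro mult_left_mono) auto
  finally show ?thesis .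
qed

text \<open>A Borel version of \<open>\<bar>f\<bar>\<close> is raised to \<open>top\<close> on a
  Borel null set containing the exceptional points. Domination everywhere avoids null sets depending
  on \<open>x\<close>, \<open>u\<close> and \<open>t\<close>, while equality almost everywhere
  preserves the square integral.\<close>

lemma lebesgue_measurable_borel_majorant:
  fixes f :: "'a::euclidean_space \<Rightarrow> real"
  assumes "f \<in> borel_measurable lebesgue"
  obtains g :: "'a \<Rightarrow> ennreal" where "g \<in> borel_measurable borel" "\<And>z. ennreal \<bar>f z\<bar> \<le> g z" "AE z in lborel. g z = ennreal \<bar>f z\<bar>"
proof -
  have "(\<lambda>z. ennreal \<bar>f z\<bar>) \<in> borel_measurable lebesgue" using assms by measurable
  then obtain g' where g' [measurable]: "g' \<in> borel_measurable lborel" and AE: "AE z in lborel. ennreal \<bar>f z\<bar> = g' z"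
    using completion_ex_borel_measurable by blast
  obtain N where N: "{z. ennreal \<bar>f z\<bar> \<noteq> g' z} \<subseteq> N" "N \<in> null_sets lborel"
    using AE unfolding eventually_ae_filter by auto
  then have [measurable]: "N \<in> sets borel" by auto
  define g where "g = (\<lambda>z. if z \<in> N then top else g' z)"
  have "g \<in> borel_measurable borel" using g' unfolding g_def by measurable
  moreover have off: "ennreal \<bar>f z\<bar> = g' z" if "z \<notin> N" for z using N(1) that by blast
  then have "ennreal \<bar>f z\<bar> \<le> g z" for z by (cases "z \<in> N") (simp_all add: g_def)
  moreover have "AE z in lborel. g z = ennreal \<bar>f z\<bar>"
    using AE_not_in[OF N(2)] AE by eventually_elim (simp add: g_def)
  ultimately show thesis using that by blast
qed

section \<open>Linearization of the maximal operator and the final estimate\<close>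

theorem theorem3p1:
  fixes T :: "'a::euclidean_space set" and C :: real
  assumes "DIM('a) \<ge> 3"
    and "compact T"
    and "\<And>\<delta>. 0 < \<delta> \<Longrightarrow> \<delta> < 1/2 \<Longrightarrow>
           real (covering_number T \<delta>) \<le> C * \<delta> powr (- (real DIM('a) - 1))"
  shows "\<exists>C'. \<forall>\<delta> f. 0 < \<delta> \<and> \<delta> < 1/2 \<and> f \<in> borel_measurable lebesgue
            \<and> integrable lebesgue (\<lambda>x. (f x)\<^sup>2) \<longrightarrow>
           (\<integral>\<^sup>+ x. (max_op \<delta> T f x)\<^sup>2 \<partial>lebesgue)
             \<le> ennreal (C'\<^sup>2 * ln (1 / \<delta>)) * (\<integral>\<^sup>+ x. ennreal ((f x)\<^sup>2) \<partial>lebesgue)"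
proof -
  obtain G where G: "G > 0"
    "\<And>(\<phi> :: 'a \<Rightarrow> 'a) \<tau> c t \<eta> K. \<phi> \<in> borel_measurable borel \<Longrightarrow> \<tau> \<in> borel_measurable borel \<Longrightarrow>
       (\<And>x. \<tau> x \<in> {1..2} \<and> (\<exists>u\<in>T. \<phi> x = x + \<tau> x *\<^sub>R u)) \<Longrightarrow> t \<in> {1..2} \<Longrightarrow>
       0 < \<eta> \<Longrightarrow> \<eta> \<le> 2 \<Longrightarrow> 8 \<le> 2 ^ K * \<eta> \<Longrightarrow> 2 ^ K * \<eta> \<le> 16 \<Longrightarrow>
       (\<integral>\<^sup>+ x. emeasure lborel (annulus c t \<eta> \<inter> annulus (\<phi> x) (\<tau> x) \<eta>) \<partial>lborel) \<le> ennreal (G * \<eta>\<^sup>2 * (real K + 1))"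
    using annulus_overlap_integral_le[OF assms] by blast
  define \<omega> where "\<omega> = unit_ball_vol (real DIM('a))"
  have \<omega>: "\<omega> > 0" by (simp add: \<omega>_def)
  \<comment> \<open>The square of \<open>1 / (\<omega> * \<delta>)\<close>, the factor
    \<open>(4 * \<delta>)\<^sup>2\<close> in the overlap bound and \<open>4 / ln 2\<close> from the
    count of scales multiply to this constant, with \<delta> cancelling.\<close>
  define Q where "Q = 64 * G / (\<omega>\<^sup>2 * ln 2)"
  have Q: "Q \<ge> 0" using G(1) by (simp add: Q_def)
  have "(\<integral>\<^sup>+ x. (max_op \<delta> T f x)\<^sup>2 \<partial>lebesgue) \<le> ennreal (Q * ln (1 / \<delta>)) * (\<integral>\<^sup>+ x. ennreal ((f x)\<^sup>2) \<partial>lebesgue)"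
    if \<delta>: "0 < \<delta>" "\<delta> < 1/2" and f: "f \<in> borel_measurable lebesgue" for \<delta> f
  proof (cases "T = {}")
    case True
    then show ?thesis by (simp add: max_op_def bot_ennreal)
  next
    case False
    obtain g :: "'a \<Rightarrow> ennreal" where g [measurable]: "g \<in> borel_measurable borel"
      and fg: "\<And>z. ennreal \<bar>f z\<bar> \<le> g z" "AE z in lborel. g z = ennreal \<bar>f z\<bar>"
      using lebesgue_measurable_borel_majorant[OF f] by blast
    \<comment> \<open>The parameters are the center offset and the radius rather than
      \<open>u\<close> and \<open>t\<close>, so a \<delta>-net of the compact set \<open>V\<close>
      is directly a net of annuli. The size of the net depends on \<delta> but never enters the
      estimate.\<close>
    define V where "V = (\<lambda>(u, t). (t *\<^sub>R u, t)) ` (T \<times> {1..2::real})"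
    have "continuous_on (T \<times> {1..2::real}) (\<lambda>(u, t). (t *\<^sub>R u, t))"
      unfolding case_prod_beta by (intro continuous_intros)
    then have "compact V"
      unfolding V_def using \<open>compact T\<close> by (intro compact_continuous_image compact_Times) auto
    have "V \<subseteq> (\<Union>p\<in>V. ball p \<delta>)" using \<delta> by auto
    then obtain J where J: "J \<subseteq> V" "finite J" "V \<subseteq> (\<Union>p\<in>J. ball p \<delta>)"
      using compactE_image[OF \<open>compact V\<close>, of V "\<lambda>p. ball p \<delta>"] by auto
    have "V \<noteq> {}" using False by (simp add: V_def)
    then have "J \<noteq> {}" using J(3) by auto
    define A where "A = (\<lambda>p x. \<integral>\<^sup>+ z. indicator (annulus (x + fst p) (snd p) (4 * \<delta>)) z * g z \<partial>lborel)"
    have A_meas: "A p \<in> borel_measurable borel" for p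
      unfolding A_def annulus_def by measurable
    obtain s where s [measurable]: "s \<in> borel \<rightarrow>\<^sub>M count_space UNIV"
      and sJ: "\<And>x. s x \<in> J" "\<And>x p. p \<in> J \<Longrightarrow> A p x \<le> A (s x) x"
      by (rule measurable_maximizer[where a = A, OF J(2) \<open>J \<noteq> {}\<close> A_meas]) blast
    define \<phi> where "\<phi> = (\<lambda>x. x + fst (s x))"
    define \<tau> where "\<tau> = (\<lambda>x. snd (s x))"
    have \<tau> [measurable]: "\<tau> \<in> borel_measurable borel"
      unfolding \<tau>_def by (rule measurable_compose[OF s]) simp
    have "(\<lambda>x. fst (s x)) \<in> borel_measurable borel"
      by (rule measurable_compose[OF s]) simp
    then have \<phi> [measurable]: "\<phi> \<in> borel_measurable borel"
      unfolding \<phi>_def by (intro borel_measurable_add) simp_all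
    have sel: "\<tau> x \<in> {1..2} \<and> (\<exists>u\<in>T. \<phi> x = x + \<tau> x *\<^sub>R u)" for x
      using sJ(1)[of x] J(1) by (auto simp: V_def \<phi>_def \<tau>_def)
    have max_le: "max_op \<delta> T f x \<le> ennreal (1 / (\<omega> * \<delta>)) * A (s x) x" for x
      unfolding max_op_def
    proof (intro SUP_least)
      fix u t assume "u \<in> T" and t: "t \<in> {1..2::real}"
      then have "(t *\<^sub>R u, t) \<in> V" by (auto simp: V_def)
      then obtain v t' where p: "(v, t') \<in> J" "dist (v, t') (t *\<^sub>R u, t) < \<delta>"
        using J(3) by auto
      then have "dist v (t *\<^sub>R u) \<le> \<delta>" "dist t' t \<le> \<delta>"
        using dist_fst_le[of "(v, t')" "(t *\<^sub>R u, t)"] dist_snd_le[of "(v, t')" "(t *\<^sub>R u, t)"] by auto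
      from sphere_average_le_annulus[OF fg(1) g \<delta>(1) t this, of x]
      have "ennreal (\<bar>set_lebesgue_integral lebesgue (sphere_nbhd \<delta>) (\<lambda>y. f (x + t *\<^sub>R (u + y)))\<bar>
          / measure lebesgue (sphere_nbhd \<delta> :: 'a set)) \<le> ennreal (1 / (\<omega> * \<delta>)) * A (v, t') x"
        by (simp add: A_def \<omega>_def)
      also have "\<dots> \<le> ennreal (1 / (\<omega> * \<delta>)) * A (s x) x"
        using sJ(2)[OF p(1)] by (intro mult_left_mono) auto
      finally show "ennreal (\<bar>set_lebesgue_integral lebesgue (sphere_nbhd \<delta>) (\<lambda>y. f (x + t *\<^sub>R (u + y)))\<bar>
          / measure lebesgue (sphere_nbhd \<delta> :: 'a set)) \<le> ennreal (1 / (\<omega> * \<delta>)) * A (s x) x" .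
    qed
    obtain K :: nat where K: "8 \<le> 2 ^ K * (4 * \<delta>)" "2 ^ K * (4 * \<delta>) \<le> 16" "real K + 1 \<le> 4 / ln 2 * ln (1 / \<delta>)"
      using dyadic_scale_exists[OF \<delta>] by blast
    define B where "B = G * (4 * \<delta>)\<^sup>2 * (real K + 1)"
    have B: "B > 0" using G(1) \<delta> by (simp add: B_def)
    \<comment> \<open>Kernel of the linearized operator. Its values are indicators, so the kernel of
      TT* is the volume of the intersection of the annuli selected at \<open>x\<close> and at
      \<open>x'\<close>, and fixing \<open>x\<close> gives the setting of the overlap
      estimate.\<close>
    define k :: "'a \<Rightarrow> 'a \<Rightarrow> ennreal" where "k = (\<lambda>x z. indicator (annulus (\<phi> x) (\<tau> x) (4 * \<delta>)) z)"
    have k: "case_prod k \<in> borel_measurable (borel \<Otimes>\<^sub>M borel)"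
      unfolding k_def annulus_def by measurable
    have As: "A (s x) x = (\<integral>\<^sup>+ z. k x z * g z \<partial>lborel)" for x
      by (simp add: A_def k_def \<phi>_def \<tau>_def)
    have "(\<integral>\<^sup>+ x'. \<integral>\<^sup>+ z. k x z * k x' z \<partial>lborel \<partial>lborel) \<le> ennreal B" for x
    proof -
      have "(\<integral>\<^sup>+ z. k x z * k x' z \<partial>lborel)
          = emeasure lborel (annulus (\<phi> x) (\<tau> x) (4 * \<delta>) \<inter> annulus (\<phi> x') (\<tau> x') (4 * \<delta>))" for x'
        by (simp add: k_def indicator_inter_arith[symmetric])
      then show ?thesis
        unfolding B_def using G(2)[of \<phi> \<tau> "\<tau> x" "4 * \<delta>" K "\<phi> x"] \<phi> \<tau> sel K \<delta> by simp
    qed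
    from nn_integral_square_le_of_TT_star[OF k g B this]
    have L2: "(\<integral>\<^sup>+ x. (A (s x) x)\<^sup>2 \<partial>lborel) \<le> ennreal B * (\<integral>\<^sup>+ z. (g z)\<^sup>2 \<partial>lborel)"
      unfolding As .
    have [measurable]: "(\<lambda>x. A (s x) x) \<in> borel_measurable borel"
      unfolding As using k by measurable
    have "(\<integral>\<^sup>+ x. (max_op \<delta> T f x)\<^sup>2 \<partial>lebesgue) = (\<integral>\<^sup>+ x. (max_op \<delta> T f x)\<^sup>2 \<partial>lborel)"
      by (rule nn_integral_completion)
    also have "\<dots> \<le> (\<integral>\<^sup>+ x. (ennreal (1 / (\<omega> * \<delta>)))\<^sup>2 * (A (s x) x)\<^sup>2 \<partial>lborel)"
      unfolding power_mult_distrib[symmetric] by (intro nn_integral_mono power_mono_ennreal max_le)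
    also have "\<dots> = (ennreal (1 / (\<omega> * \<delta>)))\<^sup>2 * (\<integral>\<^sup>+ x. (A (s x) x)\<^sup>2 \<partial>lborel)"
      by (rule nn_integral_cmult) measurable
    also have "\<dots> \<le> (ennreal (1 / (\<omega> * \<delta>)))\<^sup>2 * (ennreal B * (\<integral>\<^sup>+ z. (g z)\<^sup>2 \<partial>lborel))"
      by (intro mult_left_mono L2) auto
    also have "\<dots> = ennreal ((1 / (\<omega> * \<delta>))\<^sup>2 * B) * (\<integral>\<^sup>+ z. (g z)\<^sup>2 \<partial>lborel)"
      using \<omega> \<delta> B by (simp add: ennreal_mult ennreal_power mult.assoc)
    also have "\<dots> \<le> ennreal (Q * ln (1 / \<delta>)) * (\<integral>\<^sup>+ z. (g z)\<^sup>2 \<partial>lborel)"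
    proof (intro mult_right_mono ennreal_leI)
      have "(1 / (\<omega> * \<delta>))\<^sup>2 * B = 16 * G / \<omega>\<^sup>2 * (real K + 1)"
        using \<omega> \<delta> by (simp add: B_def field_simps power2_eq_square)
      also have "\<dots> \<le> 16 * G / \<omega>\<^sup>2 * (4 / ln 2 * ln (1 / \<delta>))"
        using G(1) K(3) by (intro mult_left_mono) auto
      also have "\<dots> = Q * ln (1 / \<delta>)" by (simp add: Q_def)
      finally show "(1 / (\<omega> * \<delta>))\<^sup>2 * B \<le> Q * ln (1 / \<delta>)" .
    qed simp
    also have "(\<integral>\<^sup>+ z. (g z)\<^sup>2 \<partial>lborel) = (\<integral>\<^sup>+ z. ennreal ((f z)\<^sup>2) \<partial>lborel)"
      using fg(2) by (intro nn_integral_cong_AE) (auto simp: ennreal_power)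
    also have "\<dots> = (\<integral>\<^sup>+ z. ennreal ((f z)\<^sup>2) \<partial>lebesgue)"
      by (rule nn_integral_completion[symmetric])
    finally show ?thesis .
  qed
  then show ?thesis using Q by (intro exI[of _ "sqrt Q"]) auto
qed

end
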